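(* Let $C_n$ denote the cycle on $n$ vertices, and let $n\ge 4$ and $t\ge 2$ be integers. If $n\equiv 1,2\pmod 3$, then $$\gamma_R(S(C_n,t))=n^{t-1}\left\lfloor\frac{2n}{3}\right\rfloor;$$ otherwise (that is, if $n\equiv 0\pmod 3$), $$\frac{n^{t-1}(2n-3)}{3}\le \gamma_R(S(C_n,t))\le \frac{n^{t-1}(2n-1)}{3}.$$
   Context: Graphs are finite and simple. For a graph $G=(V,E)$ of order $n\ge 2$ and an integer $t\ge1$, let $V^t$ be the set of words of length $t$ over the alphabet $V$; concatenation of words is written by juxtaposition and $x^{k}$ denotes the word $xx\cdots x$ of length $k$. The generalized Sierpiński graph $S(G,t)$ is the graph with vertex set $V^t$ and edge set $\{\{w x y^{r-1}, w y x^{r-1}\}: \{x,y\}\in E,\ r\in\{1,\dots,t\},\ w\in V^{t-r}\}$ (so $S(G,1)=G$). A Roman dominating function on a graph $H$ with vertex set $W$ is a map $f:W\to\{0,1,2\}$ such that every vertex $v$ with $f(v)=0$ has a neighbor $u$ with $f(u)=2$. Its weight is $\sum_{u\in W}f(u)$. The Roman domination number $\gamma_R(H)$ is the minimum weight of a Roman dominating function on $H$. *)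

theory Defs
  imports Complex_Main
begin

text \<open>A graph is a pair of a vertex set and a set of edges, each edge being an unordered pair
  of distinct vertices.\<close>

type_synonym 'a graph = "'a set \<times> 'a set set"

abbreviation verts :: "'a graph \<Rightarrow> 'a set" where
  "verts G \<equiv> fst G"

abbreviation edges :: "'a graph \<Rightarrow> 'a set set" where
  "edges G \<equiv> snd G"

definition finite_simple_graph :: "'a graph \<Rightarrow> bool" where
  "finite_simple_graph G \<longleftrightarrow>
     finite (verts G) \<and> (\<forall>e\<in>edges G. \<exists>x\<in>verts G. \<exists>y\<in>verts G. x \<noteq> y \<and> e = {x, y})"

text \<open>This is the cycle on \<open>n\<close> vertices only for \<open>n \<ge> 3\<close>.\<close>

definition cycle_graph :: "nat \<Rightarrow> nat graph" where
  "cycle_graph n = ({0..<n}, {{i, Suc i mod n} |i. i < n})"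

text \<open>Words over the alphabet \<open>verts G\<close> are lists.\<close>

definition sierpinski :: "'a graph \<Rightarrow> nat \<Rightarrow> 'a list graph" where
  "sierpinski G t =
     ({u. set u \<subseteq> verts G \<and> length u = t},
      {{w @ [x] @ replicate (r - 1) y, w @ [y] @ replicate (r - 1) x} |w x y r.
         {x, y} \<in> edges G \<and> r \<in> {1..t} \<and> set w \<subseteq> verts G \<and> length w = t - r})"

text \<open>Only the values of \<open>f\<close> on the vertex set matter.\<close>

definition roman_dominating :: "'a graph \<Rightarrow> ('a \<Rightarrow> nat) \<Rightarrow> bool" where
  "roman_dominating H f \<longleftrightarrow>
     f ` verts H \<subseteq> {0, 1, 2} \<and>
     (\<forall>v\<in>verts H. f v = 0 \<longrightarrow> (\<exists>u\<in>verts H. {v, u} \<in> edges H \<and> f u = 2))"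

definition weight :: "'a graph \<Rightarrow> ('a \<Rightarrow> nat) \<Rightarrow> nat" where
  "weight H f = (\<Sum>u\<in>verts H. f u)"

definition roman_domination_number :: "'a graph \<Rightarrow> nat" where
  "roman_domination_number H = (LEAST k. \<exists>f. roman_dominating H f \<and> weight H f = k)"

lemma roman_domination_number_attained:
  "\<exists>f. roman_dominating H f \<and> weight H f = roman_domination_number H"
proof -
  have "roman_dominating H (\<lambda>_. 1)"
    by (auto simp: roman_dominating_def)
  then show ?thesis
    unfolding roman_domination_number_def
    using LeastI_ex[of "\<lambda>k. \<exists>f. roman_dominating H f \<and> weight H f = k"] by blast
qed

lemma roman_domination_number_le:
  "roman_dominating H f \<Longrightarrow> roman_domination_number H \<le> weight H f"
  unfolding roman_domination_number_def by (rule Least_le) blast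

lemma finite_simple_graph_cycle_graph:
  assumes "3 \<le> n"
  shows "finite_simple_graph (cycle_graph n)"
proof -
  have ne: "i \<noteq> Suc i mod n" if "i < n" for i
  proof (cases "Suc i = n")
    case True
    then show ?thesis using assms by simp
  next
    case False
    then have "Suc i mod n = Suc i" using that by simp
    then show ?thesis by linarith
  qed
  have lt: "Suc i mod n < n" for i
    using assms by simp
  have "\<exists>x\<in>{0..<n}. \<exists>y\<in>{0..<n}. x \<noteq> y \<and> e = {x, y}"
    if e: "e \<in> {{i, Suc i mod n} |i. i < n}" for e
  proof -
    from e obtain i where "i < n" "e = {i, Suc i mod n}" by blast
    then show ?thesis
      using ne[of i] lt[of i] unfolding Bex_def atLeastLessThan_iff by blast
  qed
  then show ?thesis
    unfolding finite_simple_graph_def cycle_graph_def fst_conv snd_conv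
    by (intro conjI ballI finite_atLeastLessThan)
qed

lemma finite_simple_graph_sierpinski:
  assumes "finite_simple_graph G"
  shows "finite_simple_graph (sierpinski G t)"
proof -
  have fin: "finite {u. set u \<subseteq> verts G \<and> length u = t}"
    using assms by (simp add: finite_simple_graph_def finite_lists_length_eq)
  have "\<exists>a\<in>verts (sierpinski G t). \<exists>b\<in>verts (sierpinski G t). a \<noteq> b \<and> e = {a, b}"
    if "e \<in> edges (sierpinski G t)" for e
  proof -
    from that obtain w x y r where
      e: "e = {w @ [x] @ replicate (r - 1) y, w @ [y] @ replicate (r - 1) x}" and
      xy: "{x, y} \<in> edges G" and r: "r \<in> {1..t}" and
      w: "set w \<subseteq> verts G" "length w = t - r"
      unfolding sierpinski_def by auto
    obtain p q where "p \<in> verts G" "q \<in> verts G" "p \<noteq> q" "{x, y} = {p, q}"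
      using assms xy unfolding finite_simple_graph_def by blast
    then have "x \<in> verts G" "y \<in> verts G" "x \<noteq> y"
      by (auto simp: doubleton_eq_iff)
    then have *: "w @ [x] @ replicate (r - 1) y \<in> verts (sierpinski G t)"
      "w @ [y] @ replicate (r - 1) x \<in> verts (sierpinski G t)"
      "w @ [x] @ replicate (r - 1) y \<noteq> w @ [y] @ replicate (r - 1) x"
      using w r by (auto simp: sierpinski_def)
    show ?thesis
      by (intro bexI[OF _ *(1)] bexI[OF _ *(2)] conjI *(3) e)
  qed
  moreover have "finite (verts (sierpinski G t))"
    using fin unfolding sierpinski_def fst_conv .
  ultimately show ?thesis
    unfolding finite_simple_graph_def by blast
qed

end

theory Submission
  imports Defs
begin

text \<open>
  Removing the last letter splits the vertices into \<open>n ^ (t - 1)\<close> copies of the cycle, and every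
  vertex has at most one neighbour outside its copy. In the copy of a word ending in \<open>p\<close>, only
  \<open>p - 1, p, p + 1\<close> can have one.

  Lower bound: every vertex dominated only from outside its copy takes half a unit of weight from
  the copy of its dominator. A copy with weight \<open>g\<close>, with \<open>i\<close> vertices that need outside help
  and \<open>q\<close> vertices offering it, satisfies \<open>3 g + 2 i \<ge> 2 n\<close>, and \<open>i\<close>, \<open>q\<close> are at most 3
  and exclude each other unless \<open>i = q = 1\<close>. If \<open>q = 3\<close>, then \<open>p\<close> is dominated three times, which
  improves the bound to \<open>3 g \<ge> 2 n + 4\<close>. Rounding gives
  \<open>g + i / 2 - q / 2 \<ge> n - 1 - n div 3\<close> for every copy.

  Upper bound: the label of a word ending in \<open>p x\<close> depends only on \<open>p\<close> and \<open>d = x - p\<close> modulo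
  \<open>n\<close>. When \<open>n\<close> is not divisible by 3, twos at \<open>d = 1, 4, 7, \<dots>\<close>
  (with a one at \<open>d = n - 2\<close> if \<open>n mod 3 = 2\<close>) leave only \<open>d = n - 1\<close> undominated in its copy; it is served by the two at \<open>d = 1\<close> of the copy of \<open>p - 1\<close>. When 3 divides
  \<open>n\<close>, put twos where \<open>p + d\<close> is divisible by 3: each copy is perfectly dominated, and for
  \<open>3 dvd p\<close> the two at \<open>d = 0\<close> can be lowered to a one because \<open>d = 1\<close> and \<open>d = n - 1\<close> are
  dominated from outside.
\<close>

section \<open>Words and edges of generalized Sierpinski graphs\<close>

lemma verts_sierpinski: "verts (sierpinski G t) = {u. set u \<subseteq> verts G \<and> length u = t}"
  by (simp add: sierpinski_def)

text \<open>Appending a letter is a bijection, so a sum over the vertices of a Sierpinski graph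
  becomes a sum over its copies of \<open>G\<close>, indexed by the prefixes
  \<open>c\<close>.\<close>

lemma sum_words_Suc:
  "(\<Sum>u | set u \<subseteq> V \<and> length u = Suc m. F u)
     = (\<Sum>c | set c \<subseteq> V \<and> length c = m. \<Sum>x\<in>V. F (c @ [x]))"
proof -
  have "bij_betw (\<lambda>(c, x). c @ [x]) ({c. set c \<subseteq> V \<and> length c = m} \<times> V)
      {u. set u \<subseteq> V \<and> length u = Suc m}"
    by (rule bij_betw_byWitness[where f' = "\<lambda>u. (butlast u, last u)"])
      (auto simp: length_Suc_conv_rev)
  from sum.reindex_bij_betw[OF this, of F] show ?thesis
    by (simp add: sum.cartesian_product case_prod_unfold)
qed

text \<open>The edges with \<open>r \<ge> 2\<close>, which join different copies of \<open>G\<close>.\<close>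

definition sierpinski_link :: "'a graph \<Rightarrow> 'a list \<Rightarrow> 'a list \<Rightarrow> bool" where
  "sierpinski_link G u v \<longleftrightarrow>
     (\<exists>w x y k. {x, y} \<in> edges G \<and> x \<noteq> y \<and>
        u = w @ [x] @ replicate (Suc k) y \<and> v = w @ [y] @ replicate (Suc k) x)"

lemma sierpinski_link_sym:
  assumes "sierpinski_link G u v"
  shows "sierpinski_link G v u"
proof -
  obtain w x y k where 1: "{x, y} \<in> edges G" "x \<noteq> y"
    "u = w @ [x] @ replicate (Suc k) y" "v = w @ [y] @ replicate (Suc k) x"
    using assms unfolding sierpinski_link_def by blast
  then have "{y, x} \<in> edges G" "y \<noteq> x" by (simp_all add: insert_commute)
  with 1(3,4) show ?thesis unfolding sierpinski_link_def by blast
qed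

text \<open>The run of \<open>y\<close> ends at the first letter different from \<open>y\<close>,
  which fixes its length. Applied to reversed words, this recovers the decomposition in
  \<open>sierpinski_link\<close>.\<close>

lemma replicate_append_Cons_eq_iff:
  assumes "x \<noteq> y" "x' \<noteq> y"
  shows "replicate k y @ x # w = replicate k' y @ x' # w' \<longleftrightarrow> k = k' \<and> x = x' \<and> w = w'"
  using assms
proof (induction k arbitrary: k')
  case 0
  then show ?case by (cases k') auto
next
  case (Suc k)
  then show ?case by (cases k') auto
qed

text \<open>The last letter of \<open>u\<close> is \<open>y\<close>, the length of the final run
  gives \<open>k\<close>, and the letter before that run is \<open>x\<close>. Links therefore form a
  matching.\<close>

lemma sierpinski_link_unique:
  assumes "sierpinski_link G u v" "sierpinski_link G u v'"
  shows "v = v'"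
proof -
  obtain w x y k where 1: "x \<noteq> y" "u = w @ [x] @ replicate (Suc k) y"
    "v = w @ [y] @ replicate (Suc k) x"
    using assms(1) unfolding sierpinski_link_def by blast
  obtain w' x' y' k' where 2: "x' \<noteq> y'" "u = w' @ [x'] @ replicate (Suc k') y'"
    "v' = w' @ [y'] @ replicate (Suc k') x'"
    using assms(2) unfolding sierpinski_link_def by blast
  have r: "rev u = replicate (Suc k) y @ x # rev w"
    unfolding 1(2) by (simp del: replicate.simps)
  have r': "rev u = replicate (Suc k') y' @ x' # rev w'"
    unfolding 2(2) by (simp del: replicate.simps)
  then have "y = y'" using r by simp
  with r r' 1(1) 2(1) have "Suc k = Suc k' \<and> x = x' \<and> rev w = rev w'"
    using replicate_append_Cons_eq_iff by metis
  with 1 2 \<open>y = y'\<close> show ?thesis by simp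
qed

text \<open>The letter before the final \<open>a\<close> is again \<open>a\<close> if the run is
  longer than one, and otherwise it is the letter \<open>x\<close> adjacent to \<open>a\<close>. In
  a cycle this leaves at most three letters per copy.\<close>

lemma sierpinski_link_last:
  assumes "sierpinski_link G (c @ [a]) v"
  shows "a = last c \<or> {a, last c} \<in> edges G"
proof -
  obtain w x y k where 1: "{x, y} \<in> edges G" "c @ [a] = w @ [x] @ replicate (Suc k) y"
    using assms unfolding sierpinski_link_def by blast
  then have "c @ [a] = (w @ [x] @ replicate k y) @ [y]"
    by (simp add: replicate_append_same)
  then have "a = y" "c = w @ [x] @ replicate k y" by simp_all
  with 1(1) show ?thesis by (cases k) (auto simp: insert_commute)
qed

text \<open>With \<open>r = 1\<close> only the last letter changes; \<open>r \<ge> 2\<close> gives a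
  link, where simplicity of \<open>G\<close> supplies \<open>x \<noteq> y\<close>.\<close>

lemma sierpinski_edge_cases:
  assumes "finite_simple_graph G" "{u, v} \<in> edges (sierpinski G t)"
  obtains (inner) c a b where "u = c @ [a]" "v = c @ [b]" "{a, b} \<in> edges G"
    | (link) "sierpinski_link G u v"
proof -
  obtain w x y r where
    e: "{u, v} = {w @ [x] @ replicate (r - 1) y, w @ [y] @ replicate (r - 1) x}"
    and xy: "{x, y} \<in> edges G" and r: "1 \<le> r"
    using assms(2) unfolding sierpinski_def by auto
  have ne: "x \<noteq> y"
    using assms(1) xy unfolding finite_simple_graph_def by (metis doubleton_eq_iff)
  have yx: "{y, x} \<in> edges G" using xy by (simp add: insert_commute)
  show thesis
  proof (cases "r = 1")
    case True
    with e have "u = w @ [x] \<and> v = w @ [y] \<or> u = w @ [y] \<and> v = w @ [x]"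
      by (auto simp: doubleton_eq_iff)
    with xy yx inner show thesis by blast
  next
    case False
    then obtain k where "r - 1 = Suc k" using r by (cases "r - 1") auto
    with e have "u = w @ [x] @ replicate (Suc k) y \<and> v = w @ [y] @ replicate (Suc k) x
        \<or> u = w @ [y] @ replicate (Suc k) x \<and> v = w @ [x] @ replicate (Suc k) y"
      by (simp only: doubleton_eq_iff)
    then have "sierpinski_link G u v"
      unfolding sierpinski_link_def using xy yx ne by metis
    then show thesis by (rule link)
  qed
qed

lemma sierpinski_edge_inner:
  assumes "{x, y} \<in> edges G" "set c \<subseteq> verts G" "t = Suc (length c)"
  shows "{c @ [x], c @ [y]} \<in> edges (sierpinski G t)"
  unfolding sierpinski_def snd_conv mem_Collect_eq
  by (rule exI[of _ c], rule exI[of _ x], rule exI[of _ y], rule exI[of _ 1])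
    (use assms in auto)

text \<open>The case \<open>r = 2\<close>: these are the only links that the upper bound
  uses.\<close>

lemma sierpinski_edge_swap:
  assumes "{x, y} \<in> edges G" "set w \<subseteq> verts G" "t = Suc (Suc (length w))"
  shows "{w @ [x, y], w @ [y, x]} \<in> edges (sierpinski G t)"
  unfolding sierpinski_def snd_conv mem_Collect_eq
  by (rule exI[of _ w], rule exI[of _ x], rule exI[of _ y], rule exI[of _ 2])
    (use assms in auto)

section \<open>Cycles\<close>

text \<open>Adding \<open>n\<close> first keeps the truncated subtraction exact at
  \<open>x = 0\<close> for positive \<open>n\<close>.\<close>

definition cyc_pred :: "nat \<Rightarrow> nat \<Rightarrow> nat" where
  "cyc_pred n x = (x + n - 1) mod n"

lemma cyc_pred_less: "0 < n \<Longrightarrow> cyc_pred n x < n"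
  by (simp add: cyc_pred_def)

lemma cyc_pred_eq: "x < n \<Longrightarrow> cyc_pred n x = (if x = 0 then n - 1 else x - 1)"
  by (auto simp: cyc_pred_def mod_if)

lemma Suc_mod_eq: "x < n \<Longrightarrow> Suc x mod n = (if Suc x = n then 0 else Suc x)"
  by auto

lemma Suc_cyc_pred: "x < n \<Longrightarrow> Suc (cyc_pred n x) mod n = x"
  by (auto simp: cyc_pred_eq)

lemma cyc_pred_Suc: "x < n \<Longrightarrow> cyc_pred n (Suc x mod n) = x"
  by (auto simp: cyc_pred_eq Suc_mod_eq)

lemma verts_cycle_graph: "verts (cycle_graph n) = {0..<n}"
  by (simp add: cycle_graph_def)

lemma edges_cycle_graph_iff:
  assumes "x < n"
  shows "{x, y} \<in> edges (cycle_graph n) \<longleftrightarrow> y = Suc x mod n \<or> y = cyc_pred n x"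
proof -
  have "{x, y} \<in> edges (cycle_graph n) \<longleftrightarrow> y = Suc x mod n \<or> (y < n \<and> x = Suc y mod n)"
    unfolding cycle_graph_def using assms by (auto simp: doubleton_eq_iff)
  also have "\<dots> \<longleftrightarrow> y = Suc x mod n \<or> y = cyc_pred n x"
    using assms Suc_cyc_pred cyc_pred_Suc cyc_pred_less
    by (metis gr_implies_not0 neq0_conv)
  finally show ?thesis .
qed

lemma bij_betw_Suc_mod: "bij_betw (\<lambda>x. Suc x mod n) {0..<n} {0..<n}"
  by (rule bij_betw_byWitness[where f' = "cyc_pred n"])
    (auto simp: Suc_cyc_pred cyc_pred_Suc cyc_pred_less)

lemma bij_betw_cyc_pred: "bij_betw (cyc_pred n) {0..<n} {0..<n}"
  by (rule bij_betw_byWitness[where f' = "\<lambda>x. Suc x mod n"])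
    (auto simp: Suc_cyc_pred cyc_pred_Suc cyc_pred_less)

section \<open>The lower bound\<close>

text \<open>This is the balance of one copy with half units doubled: \<open>h\<close> labels the
  copy, \<open>p\<close> is the last letter of its word, \<open>I\<close> holds the vertices needing
  outside help, and \<open>Q\<close> those offering it.\<close>

lemma cycle_weight_bound:
  fixes h :: "nat \<Rightarrow> nat"
  assumes n: "3 \<le> n" and p: "p < n" and h: "\<And>x. x < n \<Longrightarrow> h x \<le> 2"
  defines "N \<equiv> {x. x < n \<and> (x = p \<or> {x, p} \<in> edges (cycle_graph n))}"
  assumes I: "I = {x. x < n \<and> h x = 0 \<and> \<not> (\<exists>y. {x, y} \<in> edges (cycle_graph n) \<and> h y = 2)}"
    and IN: "I \<subseteq> N" and Q: "Q \<subseteq> {x \<in> N. h x = 2}"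
  shows "2 * (n - 1 - n div 3) + card Q \<le> 2 * (\<Sum>x\<in>{0..<n}. h x) + card I"
proof -
  define s where "s = (\<lambda>x. Suc x mod n)"
  define q where "q = cyc_pred n"
  define tw on where "tw = (\<lambda>x. of_bool (h x = 2) :: nat)" and "on = (\<lambda>x. of_bool (h x = 1) :: nat)"
  \<comment> \<open>\<open>cnt x\<close> counts how often \<open>x\<close> is taken care of: twos in
    its closed neighbourhood, plus a label one of its own.\<close>
  define cnt where "cnt = (\<lambda>x. tw x + tw (s x) + tw (q x) + on x)"
  define a b where "a = (\<Sum>x\<in>{0..<n}. tw x)" and "b = (\<Sum>x\<in>{0..<n}. on x)"
  have sq: "s (q x) = x" "q (s x) = x" if "x < n" for x
    using that by (simp_all add: s_def q_def Suc_cyc_pred cyc_pred_Suc)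
  have lt: "s x < n" "q x < n" for x
    using n by (simp_all add: s_def q_def cyc_pred_less)
  have dist: "s p \<noteq> p" "q p \<noteq> p" "s p \<noteq> q p"
    using n p by (auto simp: s_def q_def cyc_pred_eq Suc_mod_eq)
  have adj: "{x, y} \<in> edges (cycle_graph n) \<longleftrightarrow> y = s x \<or> y = q x" if "x < n" for x y
    using edges_cycle_graph_iff[OF that] by (simp add: s_def q_def)
  have N: "N = {q p, p, s p}"
    unfolding N_def using adj[OF p] p lt by (auto simp: insert_commute)
  have Iiff: "x \<in> I \<longleftrightarrow> h x = 0 \<and> h (s x) \<noteq> 2 \<and> h (q x) \<noteq> 2" if "x < n" for x
    using that unfolding I by (auto simp: adj)
  have sum_h: "(\<Sum>x\<in>{0..<n}. h x) = 2 * a + b"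
    unfolding a_def b_def sum_distrib_left sum.distrib[symmetric]
    by (rule sum.cong) (use h in \<open>fastforce simp: tw_def on_def le_Suc_eq numeral_2_eq_2\<close>)+
  \<comment> \<open>\<open>s\<close> and \<open>q\<close> permute the cycle, so each two is counted
    three times and each one once.\<close>
  have sum_cnt: "(\<Sum>x\<in>{0..<n}. cnt x) = 3 * a + b"
    using sum.reindex_bij_betw[OF bij_betw_Suc_mod, of tw n]
      sum.reindex_bij_betw[OF bij_betw_cyc_pred, of tw n]
    by (simp add: cnt_def sum.distrib a_def b_def s_def q_def)
  have cover: "1 \<le> cnt x + of_bool (x \<in> I)" if "x < n" for x
    using h[OF that] Iiff[OF that]
    by (auto simp: cnt_def tw_def on_def le_Suc_eq numeral_2_eq_2)
  have finN: "finite N" by (simp add: N)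
  have cI: "card I = of_bool (q p \<in> I) + of_bool (p \<in> I) + of_bool (s p \<in> I)"
  proof -
    have "I = N \<inter> {x. x \<in> I}" using IN by auto
    then have "card I = (\<Sum>x\<in>N. of_bool (x \<in> I))"
      using finN by (simp add: sum_of_bool_eq)
    then show ?thesis using dist by (simp add: N)
  qed
  have sumI: "(\<Sum>x\<in>{0..<n}. of_bool (x \<in> I)) = card I"
  proof -
    have "{0..<n} \<inter> {x. x \<in> I} = I" using I by auto
    then show ?thesis by (simp add: sum_of_bool_eq)
  qed
  have tot: "n \<le> 3 * a + b + card I"
  proof -
    have "n = (\<Sum>x\<in>{0..<n}. 1)" by simp
    also have "\<dots> \<le> (\<Sum>x\<in>{0..<n}. cnt x + of_bool (x \<in> I))"
      by (rule sum_mono) (use cover in auto)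
    finally show ?thesis by (simp only: sum.distrib sumI sum_cnt)
  qed
  \<comment> \<open>Here \<open>p\<close> is counted three times where once would suffice; the
    surplus of two pays for \<open>card Q = 3\<close>.\<close>
  have tot3: "n + 2 \<le> 3 * a + b + card I" if "h (q p) = 2" "h p = 2" "h (s p) = 2"
  proof -
    have "cnt p = 3" using that by (simp add: cnt_def tw_def on_def)
    have "n + 2 = 3 + (\<Sum>x\<in>{0..<n} - {p}. 1)" using p n by simp
    also have "\<dots> \<le> cnt p + of_bool (p \<in> I) + (\<Sum>x\<in>{0..<n} - {p}. cnt x + of_bool (x \<in> I))"
      unfolding \<open>cnt p = 3\<close> by (intro add_mono sum_mono) (use cover in auto)
    also have "\<dots> = (\<Sum>x\<in>{0..<n}. cnt x + of_bool (x \<in> I))"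
      using p by (simp add: sum.remove[of "{0..<n}" p])
    finally show ?thesis by (simp only: sum.distrib sumI sum_cnt)
  qed
  have cQ: "card Q \<le> of_bool (h (q p) = 2) + of_bool (h p = 2) + of_bool (h (s p) = 2)"
  proof -
    have "card Q \<le> card (N \<inter> {x. h x = 2})"
      by (rule card_mono) (use finN Q in auto)
    also have "\<dots> = (\<Sum>x\<in>N. of_bool (h x = 2))"
      using finN by (simp add: sum_of_bool_eq)
    also have "\<dots> = of_bool (h (q p) = 2) + of_bool (h p = 2) + of_bool (h (s p) = 2)"
      using dist by (simp add: N)
    finally show ?thesis .
  qed
  have Ip: "p \<in> I \<Longrightarrow> h p = 0 \<and> h (s p) \<noteq> 2 \<and> h (q p) \<noteq> 2"
    "q p \<in> I \<Longrightarrow> h (q p) = 0 \<and> h p \<noteq> 2" "s p \<in> I \<Longrightarrow> h (s p) = 0 \<and> h p \<noteq> 2"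
    using Iiff[OF p] Iiff[OF lt(2)[of p]] Iiff[OF lt(1)[of p]] sq[OF p] by auto
  \<comment> \<open>A two at \<open>p\<close> makes \<open>I\<close> empty; a two at one neighbour
    of \<open>p\<close> leaves at most the other neighbour in \<open>I\<close>.\<close>
  have cases: "card I = 0 \<and> card Q \<le> 2 \<or> card Q = 0 \<and> card I \<le> 3 \<or> card I = 1 \<and> card Q = 1
      \<or> card I = 0 \<and> card Q = 3 \<and> n + 2 \<le> 3 * a + b"
    using Ip cI cQ tot3 by (auto split: if_splits simp: of_bool_def)
  define g where "g = (\<Sum>x\<in>{0..<n}. h x)"
  \<comment> \<open>Since \<open>g = 2 * a + b\<close>, doubling the counting inequality and passing
    to \<open>3 * g\<close> loses only \<open>b\<close>.\<close>
  have g: "2 * n \<le> 3 * g + 2 * card I" "n + 2 \<le> 3 * a + b \<Longrightarrow> 2 * n + 4 \<le> 3 * g"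
    using tot by (simp_all add: g_def sum_h)
  define k where "k = n div 3"
  have k: "n = 3 * k \<or> n = 3 * k + 1 \<or> n = 3 * k + 2"
    unfolding k_def by presburger
  have "2 * (n - 1 - k) + card Q \<le> 2 * g + card I"
    using cases
  proof (elim disjE conjE)
    assume "card I = 0" "card Q \<le> 2"
    \<comment> \<open>Integrality of \<open>g\<close> rounds \<open>3 * g \<ge> 6 * k + 4\<close> up
      to \<open>g \<ge> 2 * k + 2\<close>.\<close>
    moreover from this g(1) have "2 * k + 2 \<le> g" if "n = 3 * k + 2"
      using that by linarith
    ultimately show ?thesis using g(1) k n by (elim disjE) linarith+
  next
    assume Q0: "card Q = 0" and "card I \<le> 3"
    then consider "card I = 0" | "card I = 1" | "card I = 2" | "card I = 3" by linarith
    then show ?thesis using g(1) k n Q0 by cases (elim disjE; simp; linarith)+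
  next
    assume "card I = 1" "card Q = 1"
    with g(1) k n show ?thesis by (elim disjE) linarith+
  next
    assume "card I = 0" "card Q = 3" "n + 2 \<le> 3 * a + b"
    with g(2) k n show ?thesis by (elim disjE) linarith+
  qed
  then show ?thesis by (simp add: g_def k_def)
qed

text \<open>When \<open>cycle_weight_bound\<close> is summed over all copies, the half units cancel
  because every helped vertex has its own helper. The constant is the floor of
  \<open>2 * n / 3\<close> if 3 does not divide \<open>n\<close>, and \<open>(2 * n - 3) / 3\<close>
  otherwise.\<close>

lemma roman_domination_number_sierpinski_cycle_ge:
  assumes n: "3 \<le> n" and t: "2 \<le> t"
  shows "n ^ (t - 1) * (n - 1 - n div 3)
    \<le> roman_domination_number (sierpinski (cycle_graph n) t)"
proof -
  define C where "C = cycle_graph n"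
  define m where "m = t - 1"
  have tm: "t = Suc m" and m: "0 < m" using t by (simp_all add: m_def)
  have fsg: "finite_simple_graph C" using n by (simp add: C_def finite_simple_graph_cycle_graph)
  have vC: "verts C = {0..<n}" by (simp add: C_def verts_cycle_graph)
  obtain f where rd: "roman_dominating (sierpinski C t) f"
    and wt: "weight (sierpinski C t) f = roman_domination_number (sierpinski C t)"
    using roman_domination_number_attained by blast
  define W where "W = (\<lambda>k. {u. set u \<subseteq> {0..<n} \<and> length u = k})"
  have vS: "verts (sierpinski C t) = W t" by (simp add: verts_sierpinski vC W_def)
  have finW: "finite (W k)" for k by (simp add: W_def finite_lists_length_eq)
  \<comment> \<open>\<open>U\<close> collects the zeros without an adjacent two in their own copy,
    \<open>Q\<close> the twos with a neighbour in another copy.\<close>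
  define U where "U = {u \<in> W t. f u = 0 \<and>
      \<not> (\<exists>c a b. u = c @ [a] \<and> {a, b} \<in> edges C \<and> f (c @ [b]) = 2)}"
  define Q where "Q = {v \<in> W t. f v = 2 \<and> (\<exists>u. sierpinski_link C v u)}"
  have ex: "\<exists>v\<in>Q. sierpinski_link C u v" if u: "u \<in> U" for u
  proof -
    obtain v where v: "v \<in> W t" "{u, v} \<in> edges (sierpinski C t)" "f v = 2"
      using rd u unfolding roman_dominating_def vS U_def by blast
    from fsg v(2) show ?thesis
    proof (cases rule: sierpinski_edge_cases)
      case (inner c a b)
      with u v(3) show ?thesis unfolding U_def by blast
    next
      case link
      with v(1,3) show ?thesis unfolding Q_def using sierpinski_link_sym by blast
    qed
  qed
  then obtain g where g: "\<And>u. u \<in> U \<Longrightarrow> g u \<in> Q \<and> sierpinski_link C u (g u)" by metis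
  have "card U \<le> card Q"
  proof (rule card_inj_on_le)
    \<comment> \<open>Two vertices with the same helper would both be its unique link
      partner.\<close>
    show "inj_on g U"
      by (rule inj_onI) (metis g sierpinski_link_sym sierpinski_link_unique)
    show "g ` U \<subseteq> Q" using g by blast
    show "finite Q" using finW by (simp add: Q_def)
  qed
  have card_sum: "card A = (\<Sum>c\<in>W m. card {x. x < n \<and> c @ [x] \<in> A})" if "A \<subseteq> W t" for A
  proof -
    have "card A = (\<Sum>u\<in>W t. of_bool (u \<in> A))"
      using that finW[of t] by (simp add: sum_of_bool_eq Int_absorb1)
    also have "\<dots> = (\<Sum>c\<in>W m. \<Sum>x\<in>{0..<n}. of_bool (c @ [x] \<in> A))"
      unfolding W_def tm by (rule sum_words_Suc)
    also have "\<dots> = (\<Sum>c\<in>W m. card {x. x < n \<and> c @ [x] \<in> A})"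
      by (rule sum.cong[OF refl]) (auto simp: sum_of_bool_eq intro!: arg_cong[where f = card])
    finally show ?thesis .
  qed
  have copy: "2 * (n - 1 - n div 3) + card {x. x < n \<and> c @ [x] \<in> Q}
      \<le> 2 * (\<Sum>x\<in>{0..<n}. f (c @ [x])) + card {x. x < n \<and> c @ [x] \<in> U}" if c: "c \<in> W m" for c
  proof -
    have cW: "c @ [x] \<in> W t" if "x < n" for x
      using c that by (auto simp: W_def tm)
    \<comment> \<open>\<open>m > 0\<close>, that is \<open>t \<ge> 2\<close>, makes \<open>c\<close>
      nonempty, so \<open>last c\<close> is one of its letters.\<close>
    have "last c \<in> set c" using c m by (auto simp: W_def)
    then have "last c < n" using c by (auto simp: W_def)
    moreover have "f (c @ [x]) \<le> 2" if "x < n" for x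
      using rd cW[OF that] unfolding roman_dominating_def vS by fastforce
    moreover have "{x. x < n \<and> c @ [x] \<in> U} = {x. x < n \<and> f (c @ [x]) = 0 \<and>
        \<not> (\<exists>y. {x, y} \<in> edges (cycle_graph n) \<and> f (c @ [y]) = 2)}"
      using cW by (auto simp: U_def C_def)
    moreover have "{x. x < n \<and> c @ [x] \<in> U}
        \<subseteq> {x. x < n \<and> (x = last c \<or> {x, last c} \<in> edges (cycle_graph n))}"
      using ex sierpinski_link_last by (fastforce simp: C_def)
    moreover have "{x. x < n \<and> c @ [x] \<in> Q} \<subseteq> {x \<in> {x. x < n \<and>
        (x = last c \<or> {x, last c} \<in> edges (cycle_graph n))}. f (c @ [x]) = 2}"
      using sierpinski_link_last by (fastforce simp: C_def Q_def)
    ultimately show ?thesis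
      by (rule cycle_weight_bound[OF n, where h = "\<lambda>x. f (c @ [x])"])
  qed
  have cardW: "card (W m) = n ^ m" by (simp add: W_def card_lists_length_eq)
  have "2 * (n ^ m * (n - 1 - n div 3)) + card Q
      = (\<Sum>c\<in>W m. 2 * (n - 1 - n div 3) + card {x. x < n \<and> c @ [x] \<in> Q})"
    by (subst card_sum) (auto simp: Q_def sum.distrib cardW)
  also have "\<dots> \<le> (\<Sum>c\<in>W m. 2 * (\<Sum>x\<in>{0..<n}. f (c @ [x])) + card {x. x < n \<and> c @ [x] \<in> U})"
    by (rule sum_mono) (rule copy)
  also have "\<dots> = 2 * (\<Sum>u\<in>W t. f u) + card U"
  proof -
    have "(\<Sum>u\<in>W t. f u) = (\<Sum>c\<in>W m. \<Sum>x\<in>{0..<n}. f (c @ [x]))"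
      unfolding W_def tm by (rule sum_words_Suc)
    moreover have "card U = (\<Sum>c\<in>W m. card {x. x < n \<and> c @ [x] \<in> U})"
      by (rule card_sum) (auto simp: U_def)
    ultimately show ?thesis by (simp add: sum.distrib sum_distrib_left)
  qed
  finally have "n ^ m * (n - 1 - n div 3) \<le> (\<Sum>u\<in>W t. f u)"
    using \<open>card U \<le> card Q\<close> by linarith
  then show ?thesis
    using wt unfolding weight_def vS by (simp add: C_def m_def)
qed

section \<open>The upper bound\<close>

text \<open>\<open>\<psi> p d\<close> labels the words ending in \<open>p\<close> and
  \<open>p + d\<close>. The last two alternatives of \<open>dom\<close> come from swap edges:
  \<open>w p (p + 1)\<close> and \<open>w (p + 1) p\<close> have offsets \<open>1\<close> and
  \<open>n - 1\<close>, while \<open>w p (p - 1)\<close> and \<open>w (p - 1) p\<close> have offsets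
  \<open>n - 1\<close> and \<open>1\<close>.\<close>

lemma roman_domination_number_sierpinski_cycle_le:
  fixes \<psi> :: "nat \<Rightarrow> nat \<Rightarrow> nat"
  assumes n: "3 \<le> n" and t: "2 \<le> t"
    and le: "\<And>p d. \<psi> p d \<le> 2"
    and dom: "\<And>p d. p < n \<Longrightarrow> d < n \<Longrightarrow> \<psi> p d = 0 \<Longrightarrow>
      \<psi> p (Suc d mod n) = 2 \<or> \<psi> p (cyc_pred n d) = 2
      \<or> (d = 1 \<and> \<psi> (Suc p mod n) (n - 1) = 2) \<or> (d = n - 1 \<and> \<psi> (cyc_pred n p) 1 = 2)"
  shows "roman_domination_number (sierpinski (cycle_graph n) t)
    \<le> n ^ (t - 2) * (\<Sum>p<n. \<Sum>d<n. \<psi> p d)"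
proof -
  define C where "C = cycle_graph n"
  define k where "k = t - 2"
  have tk: "t = Suc (Suc k)" using t by (simp add: k_def)
  have vC: "verts C = {0..<n}" by (simp add: C_def verts_cycle_graph)
  define \<phi> where "\<phi> = (\<lambda>p x. \<psi> p ((x + n - p) mod n))"
  define f where "f = (\<lambda>u. \<phi> (last (butlast u)) (last u))"
  have f: "f (w @ [p, x]) = \<phi> p x" for w p x by (simp add: f_def butlast_append)
  have \<phi>: "\<phi> p ((p + d) mod n) = \<psi> p (d mod n)" if "p < n" for p d
  proof -
    have "((p + d) mod n + n - p) mod n = ((p + d) mod n + (n - p)) mod n" using that by simp
    also have "\<dots> = (p + d + (n - p)) mod n" by (rule mod_add_left_eq)
    also have "p + d + (n - p) = d + n" using that by simp
    finally show ?thesis by (simp add: \<phi>_def)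
  qed
  have shift: "bij_betw (\<lambda>d. (p + d) mod n) {0..<n} {0..<n}" if "p < n" for p
  proof (rule bij_betw_byWitness[where f' = "\<lambda>x. (x + n - p) mod n"])
    show "\<forall>a\<in>{0..<n}. ((p + a) mod n + n - p) mod n = a"
      using that by (auto simp: mod_if)
    show "\<forall>a\<in>{0..<n}. (p + (a + n - p) mod n) mod n = a"
      using that by (auto simp: mod_if)
  qed (use n in auto)
  have dominated: "\<exists>v\<in>verts (sierpinski C t). {u, v} \<in> edges (sierpinski C t) \<and> f v = 2"
    if u: "u \<in> verts (sierpinski C t)" and 0: "f u = 0" for u
  proof -
    from u obtain w p x where w: "u = w @ [p, x]" "set w \<subseteq> {0..<n}" "length w = k" "p < n" "x < n"
      unfolding verts_sierpinski vC tk
      by (auto simp: length_Suc_conv_rev)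
    obtain d where d: "d < n" "x = (p + d) mod n"
      using shift[OF w(4)] w(5) unfolding bij_betw_def
      by (metis (no_types, lifting) atLeastLessThan_iff imageE zero_le)
    have \<psi>0: "\<psi> p d = 0" using 0 d \<phi>[OF w(4), of d] by (simp add: w(1) f)
    have inner: ?thesis if "\<phi> p y = 2" "{x, y} \<in> edges C" "y < n" for y
    proof (rule bexI[of _ "w @ [p, y]"], intro conjI)
      show "{u, w @ [p, y]} \<in> edges (sierpinski C t)"
        using sierpinski_edge_inner[of x y C "w @ [p]" t] that(2) w by (simp add: vC tk)
      show "w @ [p, y] \<in> verts (sierpinski C t)"
        using w that(3) by (auto simp: verts_sierpinski vC tk)
    qed (simp add: f that(1))
    have swap: ?thesis if "\<phi> x p = 2" "{p, x} \<in> edges C"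
    proof (rule bexI[of _ "w @ [x, p]"], intro conjI)
      show "{u, w @ [x, p]} \<in> edges (sierpinski C t)"
        using sierpinski_edge_swap[of p x C w t] that(2) w by (simp add: vC tk)
      show "w @ [x, p] \<in> verts (sierpinski C t)"
        using w by (auto simp: verts_sierpinski vC tk)
    qed (simp add: f that(1))
    from dom[OF w(4) d(1) \<psi>0] consider
      (a) "\<psi> p (Suc d mod n) = 2" | (b) "\<psi> p (cyc_pred n d) = 2"
      | (c) "d = 1" "\<psi> (Suc p mod n) (n - 1) = 2"
      | (d) "d = n - 1" "\<psi> (cyc_pred n p) 1 = 2" by blast
    then show ?thesis
    proof cases
      case a
      have "Suc x mod n = (p + Suc d) mod n" by (simp add: d mod_Suc_eq)
      then have "\<phi> p (Suc x mod n) = 2" using \<phi>[OF w(4), of "Suc d"] a by simp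
      then show ?thesis
        by (rule inner) (use n w(5) in \<open>auto simp: C_def edges_cycle_graph_iff\<close>)
    next
      case b
      have "Suc ((p + cyc_pred n d) mod n) mod n = (p + Suc (cyc_pred n d) mod n) mod n"
        by (simp add: mod_Suc_eq mod_add_right_eq)
      then have "Suc ((p + cyc_pred n d) mod n) mod n = x"
        using d by (simp add: Suc_cyc_pred)
      then have "cyc_pred n x = (p + cyc_pred n d) mod n"
        using cyc_pred_Suc[of "(p + cyc_pred n d) mod n" n] n by simp
      then have "\<phi> p (cyc_pred n x) = 2"
        using \<phi>[OF w(4), of "cyc_pred n d"] b d cyc_pred_less[of n d] by simp
      then show ?thesis
        by (rule inner) (use n w(5) in \<open>auto simp: C_def edges_cycle_graph_iff cyc_pred_less\<close>)
    next
      case c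
      then have x: "x = Suc p mod n" using d by simp
      then have "p = (x + (n - 1)) mod n"
        using cyc_pred_Suc[OF w(4)] n by (simp add: cyc_pred_def)
      then have "\<phi> x p = 2" using \<phi>[OF w(5), of "n - 1"] c x n by simp
      then show ?thesis
        by (rule swap) (use w(4) x in \<open>simp add: C_def edges_cycle_graph_iff\<close>)
    next
      case d': d
      then have x: "x = cyc_pred n p" using d n by (simp add: cyc_pred_def)
      then have "p = (x + 1) mod n" using Suc_cyc_pred[OF w(4)] by simp
      then have "\<phi> x p = 2" using \<phi>[OF w(5), of 1] d' x n by simp
      then show ?thesis
        by (rule swap) (use w(4) x in \<open>simp add: C_def edges_cycle_graph_iff\<close>)
    qed
  qed
  have "f u \<in> {0, 1, 2}" for u
    using le[of "last (butlast u)"] by (auto simp: f_def \<phi>_def le_Suc_eq numeral_2_eq_2)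
  with dominated have "roman_dominating (sierpinski C t) f"
    unfolding roman_dominating_def by (simp add: image_subset_iff)
  then have "roman_domination_number (sierpinski C t) \<le> weight (sierpinski C t) f"
    by (rule roman_domination_number_le)
  also have "\<dots> = (\<Sum>w | set w \<subseteq> {0..<n} \<and> length w = k. \<Sum>p\<in>{0..<n}. \<Sum>x\<in>{0..<n}. f (w @ [p, x]))"
    unfolding weight_def verts_sierpinski vC tk sum_words_Suc by simp
  also have "\<dots> = n ^ k * (\<Sum>p\<in>{0..<n}. \<Sum>x\<in>{0..<n}. \<phi> p x)"
    by (simp add: f card_lists_length_eq)
  also have "(\<Sum>p\<in>{0..<n}. \<Sum>x\<in>{0..<n}. \<phi> p x) = (\<Sum>p\<in>{0..<n}. \<Sum>d\<in>{0..<n}. \<psi> p d)"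
  proof (rule sum.cong[OF refl])
    fix p assume p: "p \<in> {0..<n}"
    then show "(\<Sum>x\<in>{0..<n}. \<phi> p x) = (\<Sum>d\<in>{0..<n}. \<psi> p d)"
      using sum.reindex_bij_betw[OF shift, of p "\<phi> p"] \<phi> by simp
  qed
  finally show ?thesis by (simp add: C_def k_def lessThan_atLeast0)
qed

section \<open>Labellings for the three residues of \<open>n\<close> modulo 3\<close>

lemma Suc_mod_3_eq_iff:
  "Suc a mod 3 = 0 \<longleftrightarrow> a mod 3 = 2" "Suc a mod 3 = Suc 0 \<longleftrightarrow> a mod 3 = 0"
  "Suc a mod 3 = 2 \<longleftrightarrow> a mod 3 = Suc 0"
  using mod_less_divisor[of 3 a] by (auto simp: mod_Suc)

text \<open>Each block of three consecutive numbers contains the residue \<open>r\<close>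
  once.\<close>

lemma sum_mod_3:
  fixes a b :: nat
  assumes "r < 3"
  shows "(\<Sum>d<3 * k. if d mod 3 = r then a else b) = k * (a + 2 * b)"
proof (induction k)
  case (Suc k)
  have 3: "3 * Suc k = Suc (Suc (Suc (3 * k)))" by simp
  have m: "Suc (3 * k) mod 3 = 1" "Suc (Suc (3 * k)) mod 3 = 2" by presburger+
  from assms consider "r = 0" | "r = 1" | "r = 2" by linarith
  then show ?case
    unfolding 3 sum.lessThan_Suc Suc m by cases simp_all
qed simp

lemma roman_domination_number_sierpinski_cycle_le_mod_1:
  assumes n: "n = 3 * k + 1" "1 \<le> k" and t: "2 \<le> t"
  shows "roman_domination_number (sierpinski (cycle_graph n) t) \<le> n ^ (t - 1) * (2 * k)"
proof -
  obtain j where j: "t = Suc (Suc j)" using t by (metis add_2_eq_Suc le_Suc_ex)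
  define \<psi> :: "nat \<Rightarrow> nat \<Rightarrow> nat" where "\<psi> = (\<lambda>p d. if d mod 3 = 1 then 2 else 0)"
  have "roman_domination_number (sierpinski (cycle_graph n) t)
      \<le> n ^ (t - 2) * (\<Sum>p<n. \<Sum>d<n. \<psi> p d)"
  proof (rule roman_domination_number_sierpinski_cycle_le)
    fix p d assume "p < n" "d < n" "\<psi> p d = 0"
    then have "d mod 3 \<noteq> 1" by (simp add: \<psi>_def split: if_splits)
    then consider "d mod 3 = 0" "d \<noteq> n - 1" | "d mod 3 = 2" | "d = n - 1" by linarith
    then show "\<psi> p (Suc d mod n) = 2 \<or> \<psi> p (cyc_pred n d) = 2
      \<or> (d = 1 \<and> \<psi> (Suc p mod n) (n - 1) = 2) \<or> (d = n - 1 \<and> \<psi> (cyc_pred n p) 1 = 2)"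
    proof cases
      case 1
      then have "Suc d mod n mod 3 = 1" using \<open>d < n\<close> n by (simp add: mod_Suc)
      then show ?thesis by (simp add: \<psi>_def)
    next
      case 2
      then have "d \<noteq> 0" by (intro notI) simp
      then have "cyc_pred n d = d - 1" using \<open>d < n\<close> by (simp add: cyc_pred_eq)
      moreover have "(d - 1) mod 3 = 1" using 2 \<open>d \<noteq> 0\<close> Suc_mod_3_eq_iff(3)[of "d - 1"] by simp
      ultimately have "cyc_pred n d mod 3 = 1" by simp
      then show ?thesis by (simp add: \<psi>_def)
    qed (simp add: \<psi>_def)
  qed (use n t in \<open>auto simp: \<psi>_def\<close>)
  also have "(\<Sum>p<n. \<Sum>d<n. \<psi> p d) = n * (2 * k)"
    using sum_mod_3[of 1 2 0 k] by (simp add: \<psi>_def n)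
  also have "n ^ (t - 2) * (n * (2 * k)) = n ^ (t - 1) * (2 * k)"
    by (simp add: j algebra_simps)
  finally show ?thesis .
qed

lemma roman_domination_number_sierpinski_cycle_le_mod_2:
  assumes n: "n = 3 * k + 2" "1 \<le> k" and t: "2 \<le> t"
  shows "roman_domination_number (sierpinski (cycle_graph n) t) \<le> n ^ (t - 1) * (2 * k + 1)"
proof -
  obtain j where j: "t = Suc (Suc j)" using t by (metis add_2_eq_Suc le_Suc_ex)
  \<comment> \<open>The bound \<open>d < 3 * k\<close> excludes \<open>d = 3 * k + 1\<close>, which
    is also 1 modulo 3 but is left to the copy of \<open>p - 1\<close>.\<close>
  define \<psi> :: "nat \<Rightarrow> nat \<Rightarrow> nat" where
    "\<psi> = (\<lambda>p d. if d = 3 * k then 1 else if d < 3 * k \<and> d mod 3 = 1 then 2 else 0)"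
  have "roman_domination_number (sierpinski (cycle_graph n) t)
      \<le> n ^ (t - 2) * (\<Sum>p<n. \<Sum>d<n. \<psi> p d)"
  proof (rule roman_domination_number_sierpinski_cycle_le)
    fix p d assume "p < n" "d < n" "\<psi> p d = 0"
    then have "d mod 3 \<noteq> 1 \<and> d < 3 * k \<or> d = n - 1"
      using n by (auto simp: \<psi>_def split: if_splits)
    then consider "d mod 3 = 0" "d < 3 * k" | "d mod 3 = 2" "d < 3 * k" | "d = n - 1" by linarith
    then show "\<psi> p (Suc d mod n) = 2 \<or> \<psi> p (cyc_pred n d) = 2
      \<or> (d = 1 \<and> \<psi> (Suc p mod n) (n - 1) = 2) \<or> (d = n - 1 \<and> \<psi> (cyc_pred n p) 1 = 2)"
    proof cases
      case 1
      then have "Suc d mod n = Suc d" "Suc d mod 3 = 1" using n by (simp_all add: mod_Suc)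
      moreover have "Suc d < 3 * k" using 1 by presburger
      ultimately show ?thesis by (simp add: \<psi>_def)
    next
      case 2
      then have "d \<noteq> 0" by (intro notI) simp
      then have "cyc_pred n d = d - 1" using \<open>d < n\<close> by (simp add: cyc_pred_eq)
      moreover have "(d - 1) mod 3 = 1" using 2 \<open>d \<noteq> 0\<close> Suc_mod_3_eq_iff(3)[of "d - 1"] by simp
      moreover have "d - 1 < 3 * k" using 2 by simp
      ultimately have "\<psi> p (cyc_pred n d) = 2" unfolding \<psi>_def by auto
      then show ?thesis by simp
    qed (use n in \<open>simp add: \<psi>_def\<close>)
  qed (use n t in \<open>auto simp: \<psi>_def\<close>)
  also have "(\<Sum>p<n. \<Sum>d<n. \<psi> p d) = n * (2 * k + 1)"
  proof -
    have "(\<Sum>d<3 * k. \<psi> p d) = (\<Sum>d<3 * k. if d mod 3 = 1 then 2 else 0)" for p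
      by (rule sum.cong) (auto simp: \<psi>_def)
    moreover have "(\<Sum>d<n. \<psi> p d) = (\<Sum>d<3 * k. \<psi> p d) + 1" for p
      by (simp add: n) (simp add: \<psi>_def)
    ultimately show ?thesis using sum_mod_3[of 1 2 0 k] by simp
  qed
  also have "n ^ (t - 2) * (n * (2 * k + 1)) = n ^ (t - 1) * (2 * k + 1)"
    by (simp add: j algebra_simps)
  finally show ?thesis .
qed

text \<open>For a fixed \<open>w\<close>, the \<open>k\<close> copies with \<open>p\<close>
  divisible by 3 weigh \<open>2 * k - 1\<close> each and the other \<open>2 * k\<close> copies weigh
  \<open>2 * k\<close> each, in total \<open>k * (6 * k - 1)\<close>.\<close>

lemma roman_domination_number_sierpinski_cycle_le_mod_0:
  assumes n: "n = 3 * k" "2 \<le> k" and t: "2 \<le> t"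
  shows "roman_domination_number (sierpinski (cycle_graph n) t) \<le> n ^ (t - 2) * (k * (6 * k - 1))"
proof -
  define \<psi> :: "nat \<Rightarrow> nat \<Rightarrow> nat" where
    "\<psi> = (\<lambda>p d. if p mod 3 = 0 \<and> d = 0 then 1 else if (p + d) mod 3 = 0 then 2 else 0)"
  have "roman_domination_number (sierpinski (cycle_graph n) t)
      \<le> n ^ (t - 2) * (\<Sum>p<n. \<Sum>d<n. \<psi> p d)"
  proof (rule roman_domination_number_sierpinski_cycle_le)
    fix p d assume pd: "p < n" "d < n" "\<psi> p d = 0"
    \<comment> \<open>Since 3 divides \<open>n\<close>, reducing modulo \<open>n\<close> preserves
      residues modulo 3.\<close>
    have S: "Suc x mod n mod 3 = Suc x mod 3" "(cyc_pred n x + 1) mod 3 = x mod 3"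
      if "x < n" for x
      using that n Suc_cyc_pred[of x n] mod_mod_cancel[of 3 n] by (metis Suc_eq_plus1 dvd_triv_left)+
    have S0: "(y + Suc x mod n) mod 3 = (y + Suc x) mod 3"
      "(y + cyc_pred n x + 1) mod 3 = (y + x) mod 3" if "x < n" for x y
      using S[OF that] by (metis mod_add_right_eq, metis mod_add_right_eq add.assoc)
    have d: "(p + d) mod 3 \<noteq> 0" using pd(3) by (simp add: \<psi>_def split: if_splits)
    then consider "(p + d) mod 3 = 2" | "(p + d) mod 3 = 1" by linarith
    then show "\<psi> p (Suc d mod n) = 2 \<or> \<psi> p (cyc_pred n d) = 2
      \<or> (d = 1 \<and> \<psi> (Suc p mod n) (n - 1) = 2) \<or> (d = n - 1 \<and> \<psi> (cyc_pred n p) 1 = 2)"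
    proof cases
      case 1
      then have z: "(p + Suc d mod n) mod 3 = 0"
        using S0(1)[OF pd(2), of p] by (simp add: Suc_mod_3_eq_iff)
      show ?thesis
      proof (cases "p mod 3 = 0 \<and> Suc d mod n = 0")
        case True
        \<comment> \<open>The successor is the lowered vertex, so the two at offset 1 of the copy of
          \<open>p - 1\<close> takes over.\<close>
        then have "d = n - 1" using pd(2) by (auto simp: Suc_mod_eq split: if_splits)
        moreover have "(cyc_pred n p + 1) mod 3 = 0" using True S(2)[OF pd(1)] by simp
        ultimately show ?thesis by (simp add: \<psi>_def)
      next
        case False
        then have "\<psi> p (Suc d mod n) = 2"
          by (simp only: \<psi>_def z if_True if_False simp_thms)
        then show ?thesis by simp
      qed
    next
      case 2
      then have z: "(p + cyc_pred n d) mod 3 = 0"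
        using S0(2)[OF pd(2), of p] Suc_mod_3_eq_iff(2)[of "p + cyc_pred n d"] by simp
      show ?thesis
      proof (cases "p mod 3 = 0 \<and> cyc_pred n d = 0")
        case True
        \<comment> \<open>The predecessor is the lowered vertex, so the two at offset
          \<open>n - 1\<close> of the copy of \<open>p + 1\<close> takes over.\<close>
        then have "d = 1" using pd(2) n by (auto simp: cyc_pred_eq split: if_splits)
        \<comment> \<open>Passing to the successor replaces \<open>n - 1\<close> by
          \<open>3 * k\<close>, which vanishes modulo 3.\<close>
        moreover have "Suc (Suc p mod n + (n - 1)) mod 3 = Suc 0"
        proof -
          have "Suc (Suc p mod n + (n - 1)) = Suc p mod n + 3 * k" using n by simp
          then show ?thesis
            using True S(1)[OF pd(1)] by (simp only:) (simp add: Suc_mod_3_eq_iff)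
        qed
        then have "(Suc p mod n + (n - 1)) mod 3 = 0"
          by (simp only: Suc_mod_3_eq_iff)
        ultimately show ?thesis using n by (simp add: \<psi>_def)
      next
        case False
        then have "\<psi> p (cyc_pred n d) = 2"
          by (simp only: \<psi>_def z if_True if_False simp_thms)
        then show ?thesis by simp
      qed
    qed
  qed (use n t in \<open>auto simp: \<psi>_def\<close>)
  also have "(\<Sum>p<n. \<Sum>d<n. \<psi> p d) = k * (6 * k - 1)"
  proof -
    have 2: "(\<Sum>d<3 * k. if (p + d) mod 3 = 0 then 2 else 0) = 2 * k" for p :: nat
    proof -
      have small: "(a + b) mod 3 = 0 \<longleftrightarrow> b = (3 - a) mod 3" if "a < 3" "b < 3" for a b :: nat
      proof -
        from that have "a \<in> {0, 1, 2}" "b \<in> {0, 1, 2}" by auto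
        then show ?thesis by (elim insertE emptyE) simp_all
      qed
      \<comment> \<open>\<open>(3 - p mod 3) mod 3\<close> is the residue of \<open>- p\<close>, so
        the unlowered twos fill exactly one residue class of offsets.\<close>
      have e: "(p + d) mod 3 = 0 \<longleftrightarrow> d mod 3 = (3 - p mod 3) mod 3" for d
        using small[of "p mod 3" "d mod 3"] unfolding mod_add_eq by simp
      show ?thesis
        unfolding e by (rule trans[OF sum_mod_3]) simp_all
    qed
    have row: "(\<Sum>d<n. \<psi> p d) = (if p mod 3 = 0 then 2 * k - 1 else 2 * k)" for p
    proof (cases "p mod 3 = 0")
      case True
      \<comment> \<open>Adding one at offset 0 undoes the lowering and restores the regular
        pattern.\<close>
      have "(\<Sum>d<n. \<psi> p d) + 1 = (\<Sum>d<n. \<psi> p d + of_bool (d = 0))"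
        using n by (simp add: sum.distrib of_bool_def)
      also have "\<dots> = (\<Sum>d<3 * k. if (p + d) mod 3 = 0 then 2 else 0)"
        by (rule sum.cong) (use True n in \<open>auto simp: \<psi>_def\<close>)
      finally show ?thesis using 2 True by simp
    next
      case False
      then show ?thesis using 2[of p] by (simp add: \<psi>_def n)
    qed
    have "(\<Sum>p<n. \<Sum>d<n. \<psi> p d) = k * (2 * k - 1 + 2 * (2 * k))"
      unfolding row unfolding n(1) by (rule sum_mod_3) simp
    also have "2 * k - 1 + 2 * (2 * k) = 6 * k - 1" using n by simp
    finally show ?thesis .
  qed
  finally show ?thesis .
qed

theorem theorem13:
  fixes n t :: nat
  assumes "n \<ge> 4" and "t \<ge> 2"
  shows "(n mod 3 = 1 \<or> n mod 3 = 2 \<longrightarrow>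
            int (roman_domination_number (sierpinski (cycle_graph n) t))
              = int n ^ (t - 1) * \<lfloor>2 * real n / 3\<rfloor>) \<and>
         (n mod 3 = 0 \<longrightarrow>
            real n ^ (t - 1) * (2 * real n - 3) / 3
              \<le> real (roman_domination_number (sierpinski (cycle_graph n) t)) \<and>
            real (roman_domination_number (sierpinski (cycle_graph n) t))
              \<le> real n ^ (t - 1) * (2 * real n - 1) / 3)"
proof -
  define g where "g = roman_domination_number (sierpinski (cycle_graph n) t)"
  define k where "k = n div 3"
  have k: "1 \<le> k" using assms(1) by (simp add: k_def)
  have lower: "n ^ (t - 1) * (n - 1 - k) \<le> g"
    unfolding g_def k_def
    by (rule roman_domination_number_sierpinski_cycle_ge) (use assms in auto)
  have "n = 3 * k \<or> n = 3 * k + 1 \<or> n = 3 * k + 2"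
    unfolding k_def by presburger
  then consider (0) "n = 3 * k" | (1) "n = 3 * k + 1" | (2) "n = 3 * k + 2" by blast
  then show ?thesis
  proof cases
    case 0
    then have k2: "2 \<le> k" using assms(1) by simp
    obtain j where j: "t = Suc (Suc j)" using assms(2) by (metis add_2_eq_Suc le_Suc_ex)
    have "g \<le> n ^ j * (k * (6 * k - 1))"
      using roman_domination_number_sierpinski_cycle_le_mod_0[OF 0 k2 assms(2)] by (simp add: g_def j)
    then have "real g \<le> real (n ^ j * (k * (6 * k - 1)))" by (simp only: of_nat_le_iff)
    \<comment> \<open>With \<open>n = 3 * k\<close>, the factor \<open>k * (6 * k - 1)\<close> is
      \<open>n * (2 * n - 1) / 3\<close>, and its \<open>n\<close> raises the exponent from
      \<open>t - 2\<close> to \<open>t - 1\<close>.\<close>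
    also have "\<dots> = real n ^ (t - 1) * (2 * real n - 1) / 3"
      using k by (simp add: j 0 of_nat_diff algebra_simps)
    finally have "real g \<le> real n ^ (t - 1) * (2 * real n - 1) / 3" .
    moreover have "real n ^ (t - 1) * (2 * real n - 3) / 3 \<le> real g"
    proof -
      have "real n ^ (t - 1) * (2 * real n - 3) / 3 = real (n ^ (t - 1) * (n - 1 - k))"
        using k 0 by (simp add: of_nat_diff field_simps)
      also have "\<dots> \<le> real g" using lower by (simp only: of_nat_le_iff)
      finally show ?thesis .
    qed
    moreover have "n mod 3 = 0" using 0 by simp
    ultimately show ?thesis unfolding g_def[symmetric] by simp
  next
    case 1
    have "g \<le> n ^ (t - 1) * (2 * k)"
      unfolding g_def by (rule roman_domination_number_sierpinski_cycle_le_mod_1[OF 1 k assms(2)])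
    moreover have "n - 1 - k = 2 * k" using 1 by simp
    ultimately have "g = n ^ (t - 1) * (2 * k)" using lower by simp
    moreover have "\<lfloor>2 * real n / 3\<rfloor> = 2 * int k" using 1 by (simp add: floor_eq_iff)
    moreover have "n mod 3 = 1" using 1 by presburger
    ultimately show ?thesis unfolding g_def[symmetric] by (simp add: algebra_simps)
  next
    case 2
    have "g \<le> n ^ (t - 1) * (2 * k + 1)"
      unfolding g_def by (rule roman_domination_number_sierpinski_cycle_le_mod_2[OF 2 k assms(2)])
    moreover have "n - 1 - k = 2 * k + 1" using 2 by simp
    ultimately have "g = n ^ (t - 1) * (2 * k + 1)" using lower by simp
    moreover have "\<lfloor>2 * real n / 3\<rfloor> = 2 * int k + 1" using 2 by (simp add: floor_eq_iff)
    moreover have "n mod 3 = 2" using 2 by presburger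
    ultimately show ?thesis unfolding g_def[symmetric] by (simp add: algebra_simps)
  qed
qed

end
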